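(* Let $p$ be an odd prime. Then $$\sum_{k=0}^{p-1}\frac{\binom{2k}{k}T_{2k}}{4^k}\equiv\left(\frac{-2}{p}\right)\pmod p.$$
   Context: For $n\ge0$, $T_n$ is the central trinomial coefficient, i.e. the coefficient of $x^n$ in $(x^2+x+1)^n$; equivalently $T_n=\sum_{k=0}^{\lfloor n/2\rfloor}\binom{n}{2k}\binom{2k}{k}$. $\left(\frac{\cdot}{p}\right)$ is the Legendre symbol. The congruence is between rational numbers with denominators prime to $p$ (in $\mathbb{Z}_{(p)}$). *)

theory Defs
  imports
    "HOL-Number_Theory.Number_Theory"
    "HOL-Computational_Algebra.Polynomial"
begin

definition central_trinomial :: "nat \<Rightarrow> int" where
  "central_trinomial n = coeff ([:1, 1, 1:] ^ n) n"

(* The ring of rationals whose denominator is prime to p (the localization of the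
   integers at p when p is prime). *)
definition Z_loc :: "nat \<Rightarrow> rat set" where
  "Z_loc p = {x. \<exists>a b :: int. b \<noteq> 0 \<and> coprime b (int p) \<and> x = of_int a / of_int b}"

(* Congruence modulo the ideal generated by p in that ring; both sides are required
   to lie in the ring. *)
definition rat_cong :: "nat \<Rightarrow> rat \<Rightarrow> rat \<Rightarrow> bool" where
  "rat_cong p x y \<longleftrightarrow>
     x \<in> Z_loc p \<and> y \<in> Z_loc p \<and> (\<exists>z \<in> Z_loc p. x - y = of_nat p * z)"

end

theory Submission
  imports Defs
begin

text \<open>
  Write \<open>p = 2n + 1\<close> and \<open>q = 1 + x + x\<^sup>2\<close>. Modulo \<open>p\<close> one has
  \<open>binom(2k, k) / 4\<^sup>k = (-1)\<^sup>k binom(n, k)\<close>, and \<open>T\<^sub>2\<^sub>k\<close> is the coefficient of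
  \<open>x\<^sup>2\<^sup>n\<close> in \<open>x\<^sup>2\<^sup>n\<^sup>-\<^sup>2\<^sup>k q\<^sup>2\<^sup>k\<close>. So by the binomial theorem the sum becomes the coefficient of
  \<open>x\<^sup>2\<^sup>n\<close> in \<open>(x\<^sup>2 - q\<^sup>2)\<^sup>n = (-1)\<^sup>n (1 + x\<^sup>2)\<^sup>n (1 + x)\<^sup>2\<^sup>n\<close>. As \<open>binom(p - 1, j) = (-1)\<^sup>j\<close>
  modulo \<open>p\<close>, this is \<open>(-1)\<^sup>n\<close> times the sum of all \<open>binom(n, i)\<close>, that is \<open>(-2)\<^sup>n\<close>, and
  Euler's criterion applies.
\<close>

text \<open>By Pascal's rule, two neighbouring entries of row \<open>p - 1\<close> add up to an
  inner entry of row \<open>p\<close>, which \<open>p\<close> divides; so the sign alternates along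
  the row, starting from 1.\<close>

lemma cong_choose_prime_minus_one:
  assumes "prime p" "j < p"
  shows "[int ((p - 1) choose j) = (- 1) ^ j] (mod int p)"
  using assms(2)
proof (induction j)
  case 0
  then show ?case by simp
next
  case (Suc j)
  have "p choose Suc j = ((p - 1) choose j) + ((p - 1) choose Suc j)"
    using choose_reduce_nat[of p "Suc j"] Suc.prems by simp
  moreover have "p dvd (p choose Suc j)"
    using assms(1) Suc.prems by (intro dvd_choose_prime) auto
  ultimately have "int p dvd int ((p - 1) choose j) + int ((p - 1) choose Suc j)"
    by (metis of_nat_add of_nat_dvd_iff)
  moreover have "int p dvd int ((p - 1) choose j) - (- 1) ^ j"
    using Suc by (simp add: cong_iff_dvd_diff)
  ultimately have "int p dvd (int ((p - 1) choose j) + int ((p - 1) choose Suc j))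
      - (int ((p - 1) choose j) - (- 1) ^ j)"
    by (rule dvd_diff)
  then show ?case by (simp add: cong_iff_dvd_diff)
qed

lemma Suc_times_binomial_Suc: "Suc k * (n choose Suc k) = (n - k) * (n choose k)"
  by (metis binomial_absorb_comp binomial_absorption)

lemma Suc_times_central_binomial_Suc:
  "Suc k * ((2 * Suc k) choose Suc k) = 2 * (2 * k + 1) * ((2 * k) choose k)"
proof -
  have "Suc k * ((2 * Suc k) choose Suc k) = 2 * (Suc k * (Suc (2 * k) choose k))"
    using Suc_times_binomial[of k "Suc (2 * k)"] by (simp only: mult_Suc_right add_2_eq_Suc) simp
  also have "Suc k * (Suc (2 * k) choose k) = (2 * k + 1) * ((2 * k) choose k)"
    using binomial_absorb_comp[of "Suc (2 * k)" k] by (simp add: Suc_diff_le del: binomial_Suc_Suc)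
  finally show ?thesis by simp
qed

text \<open>Modulo \<open>p = 2 * n + 1\<close> both sides start at 1 and obey the same first-order
  recurrence in \<open>k\<close>, whose leading factor \<open>Suc k < p\<close> is invertible. The
  range of \<open>k\<close> runs beyond \<open>n\<close>, where both sides vanish modulo
  \<open>p\<close>.\<close>

lemma cong_central_binomial:
  fixes n k :: nat
  assumes "prime (2 * n + 1)" "k < 2 * n + 1"
  shows "[int ((2 * k) choose k) = (- 4) ^ k * int (n choose k)] (mod int (2 * n + 1))"
  using assms(2)
proof (induction k)
  case 0
  then show ?case by simp
next
  case (Suc k)
  have "coprime (Suc k) (2 * n + 1)"
    using assms(1) Suc.prems
    by (metis coprime_commute nat_dvd_not_less prime_imp_coprime zero_less_Suc)
  then have coprime: "coprime (int (Suc k)) (int (2 * n + 1))"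
    by (simp only: coprime_int_iff)
  \<comment> \<open>Over the integers \<open>n - k\<close> may be negative, but for
    \<open>k > n\<close> both binomials are 0, so the recurrence persists.\<close>
  have binom: "int (Suc k) * int (n choose Suc k) = (int n - int k) * int (n choose k)"
  proof (cases "k \<le> n")
    case True
    then show ?thesis
      using arg_cong[OF Suc_times_binomial_Suc[of k n], of int] by (simp only: of_nat_mult of_nat_diff)
  qed (simp add: binomial_eq_0)
  have "int (Suc k) * int ((2 * Suc k) choose Suc k) = int (2 * (2 * k + 1)) * int ((2 * k) choose k)"
    using arg_cong[OF Suc_times_central_binomial_Suc[of k], of int] by (simp only: of_nat_mult)
  moreover have "[int (2 * (2 * k + 1)) * int ((2 * k) choose k)
      = - 4 * (int n - int k) * ((- 4) ^ k * int (n choose k))] (mod int (2 * n + 1))"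
  proof (rule cong_mult)
    \<comment> \<open>The two recurrence factors differ by \<open>4 * n + 2\<close>, twice the
      modulus.\<close>
    have "int (2 * (2 * k + 1)) - - 4 * (int n - int k) = int (2 * n + 1) * 2"
      by simp
    then show "[int (2 * (2 * k + 1)) = - 4 * (int n - int k)] (mod int (2 * n + 1))"
      by (metis cong_iff_dvd_diff dvd_triv_left)
  qed (use Suc in simp)
  moreover have "- 4 * (int n - int k) * ((- 4) ^ k * int (n choose k))
      = int (Suc k) * ((- 4) ^ Suc k * int (n choose Suc k))"
    using arg_cong[OF binom, of "\<lambda>x. (- 4) ^ Suc k * x"] by (simp add: algebra_simps)
  ultimately have "[int (Suc k) * int ((2 * Suc k) choose Suc k)
      = int (Suc k) * ((- 4) ^ Suc k * int (n choose Suc k))] (mod int (2 * n + 1))"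
    by metis
  then show ?case
    using cong_mult_lcancel coprime by blast
qed

lemma sum_choose_central_trinomial:
  "(\<Sum>k\<le>n. (- 1) ^ k * int (n choose k) * central_trinomial (2 * k))
    = (- 1) ^ n * (\<Sum>i\<le>n. int (n choose i) * int ((2 * n) choose (2 * i)))"
proof -
  define q :: "int poly" where "q = [:1, 1, 1:]"
  \<comment> \<open>Padding with a power of \<open>x\<^sup>2\<close> moves every coefficient to the
    common degree \<open>2 * n\<close>, so that the sum becomes one coefficient.\<close>
  have shift: "central_trinomial (2 * k) = coeff ((q\<^sup>2) ^ k * (monom 1 2) ^ (n - k)) (2 * n)"
    if "k \<le> n" for k
  proof -
    have "(q\<^sup>2) ^ k * (monom 1 2) ^ (n - k) = monom 1 (2 * (n - k)) * q ^ (2 * k)"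
      by (simp add: monom_power mult.commute flip: power_mult)
    then show ?thesis
      using that by (simp add: coeff_monom_mult central_trinomial_def q_def right_diff_distrib')
  qed
  \<comment> \<open>A difference of squares: \<open>q - x = 1 + x\<^sup>2\<close> and
    \<open>q + x = (1 + x)\<^sup>2\<close>.\<close>
  have factor: "- q\<^sup>2 + monom 1 2 = - ((monom 1 2 + 1) * [:1, 1:]\<^sup>2)"
    by (simp add: q_def power2_eq_square monom_altdef numeral_2_eq_2 one_pCons)
  have "(\<Sum>k\<le>n. (- 1) ^ k * int (n choose k) * central_trinomial (2 * k))
      = coeff ((- q\<^sup>2 + monom 1 2) ^ n) (2 * n)"
    unfolding binomial_ring coeff_sum
  proof (intro sum.cong refl)
    fix k assume "k \<in> {..n}"
    have "of_nat (n choose k) * (- q\<^sup>2) ^ k * (monom 1 2) ^ (n - k)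
        = smult ((- 1) ^ k * int (n choose k)) ((q\<^sup>2) ^ k * (monom 1 2) ^ (n - k))"
      by (cases "even k") (simp_all add: of_nat_poly)
    then show "(- 1) ^ k * int (n choose k) * central_trinomial (2 * k)
        = coeff (of_nat (n choose k) * (- q\<^sup>2) ^ k * (monom 1 2) ^ (n - k)) (2 * n)"
      using shift \<open>k \<in> {..n}\<close> by simp
  qed
  also have "(- q\<^sup>2 + monom 1 2) ^ n = smult ((- 1) ^ n) ((monom 1 2 + 1) ^ n * [:1, 1:] ^ (2 * n))"
    unfolding factor power_mult by (cases "even n") (simp_all add: power_mult_distrib)
  also have "(monom 1 2 + 1 :: int poly) ^ n = (\<Sum>i\<le>n. monom (int (n choose i)) (2 * i))"
    by (simp add: binomial_ring monom_power of_nat_poly smult_monom)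
  also have "coeff (smult ((- 1) ^ n) (\<dots> * [:1, 1:] ^ (2 * n))) (2 * n)
      = (- 1) ^ n * (\<Sum>i\<le>n. int (n choose i) * coeff ([:1, 1:] ^ (2 * n)) (2 * (n - i)))"
    by (simp add: sum_distrib_right coeff_sum coeff_monom_mult right_diff_distrib')
  \<comment> \<open>The symmetry of row \<open>2 * n\<close> turns the index
    \<open>2 * (n - i)\<close> into \<open>2 * i\<close>.\<close>
  also have "(\<Sum>i\<le>n. int (n choose i) * coeff ([:1, 1:] ^ (2 * n)) (2 * (n - i)))
      = (\<Sum>i\<le>n. int (n choose i) * int ((2 * n) choose (2 * i)))"
    by (intro sum.cong refl)
      (simp add: coeff_linear_poly_power binomial_symmetric[of "2 * _"] right_diff_distrib')
  finally show ?thesis .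
qed

lemma cong_sum_choose_central_trinomial:
  assumes "prime (2 * n + 1)"
  shows "[(\<Sum>k\<le>n. (- 1) ^ k * int (n choose k) * central_trinomial (2 * k)) = (- 2) ^ n]
    (mod int (2 * n + 1))"
proof -
  \<comment> \<open>Only even positions of row \<open>p - 1\<close> occur, so every sign is
    positive.\<close>
  have "[int ((2 * n) choose (2 * i)) = 1] (mod int (2 * n + 1))" if "i \<le> n" for i
    using cong_choose_prime_minus_one[OF assms, of "2 * i"] that by simp
  then have "[(- 1) ^ n * (\<Sum>i\<le>n. int (n choose i) * int ((2 * n) choose (2 * i)))
      = (- 1) ^ n * (\<Sum>i\<le>n. int (n choose i) * 1)] (mod int (2 * n + 1))"
    by (intro cong_mult cong_sum cong_refl) auto
  also have "(- 1) ^ n * (\<Sum>i\<le>n. int (n choose i) * 1) = (- 2) ^ n"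
    using choose_row_sum[of n] by (simp flip: of_nat_sum power_mult_distrib)
  finally show ?thesis
    by (simp only: sum_choose_central_trinomial)
qed

text \<open>This carries an integer congruence over to \<open>Z_loc p\<close>: if
  \<open>a - c * b = p * d\<close>, dividing by \<open>b\<close>, a unit there, gives the witness
  \<open>d / b\<close>.\<close>

lemma rat_cong_of_int_divide:
  assumes "coprime b (int p)" "b \<noteq> 0" "[a = c * b] (mod int p)"
  shows "rat_cong p (of_int a / of_int b) (of_int c)"
proof -
  obtain d where "a - c * b = int p * d"
    using assms(3) by (auto simp: cong_iff_dvd_diff)
  then have "(of_int a - of_int c * of_int b :: rat) = of_nat p * of_int d"
    by (metis of_int_diff of_int_mult of_int_of_nat_eq)
  then have "(of_int a / of_int b - of_int c :: rat) = of_nat p * (of_int d / of_int b)"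
    using assms(2) by (simp add: field_simps)
  moreover have "of_int e / of_int b \<in> Z_loc p" for e
    using assms(1,2) by (auto simp: Z_loc_def)
  moreover have "of_int c \<in> Z_loc p"
    unfolding Z_loc_def by (intro CollectI exI[of _ c] exI[of _ 1]) simp
  ultimately show ?thesis
    unfolding rat_cong_def by blast
qed

theorem theorem2p2:
  fixes p :: nat
  assumes "prime p" and "odd p"
  shows "rat_cong p
    (\<Sum>k = 0..p - 1. of_nat ((2 * k) choose k) * of_int (central_trinomial (2 * k)) / 4 ^ k)
    (of_int (Legendre (- 2) (int p)))"
proof -
  obtain n where p: "p = 2 * n + 1"
    using assms(2) by (rule oddE)
  have "p > 2"
    using assms prime_ge_2_nat[of p] by (cases "p = 2") auto
  have "coprime 2 (int p)"
    using assms(2) by simp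
  then have coprime: "coprime ((4 :: int) ^ (p - 1)) (int p)"
    using coprime_power_left_iff[of "2 :: int" 2 "int p"] by simp
  \<comment> \<open>The numerator of the sum over the common denominator \<open>4 ^ (p - 1)\<close>,
    which is prime to \<open>p\<close>.\<close>
  define A where "A = (\<Sum>k = 0..p - 1.
    int ((2 * k) choose k) * central_trinomial (2 * k) * 4 ^ (p - 1 - k))"
  have "[A = (\<Sum>k = 0..p - 1. ((- 4) ^ k * int (n choose k)) * central_trinomial (2 * k)
      * 4 ^ (p - 1 - k))] (mod int p)"
    unfolding A_def p
    by (intro cong_sum cong_mult cong_refl cong_central_binomial) (use assms(1) p in auto)
  also have "(\<Sum>k = 0..p - 1. ((- 4) ^ k * int (n choose k)) * central_trinomial (2 * k)
      * 4 ^ (p - 1 - k))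
    = (\<Sum>k = 0..p - 1. (- 1) ^ k * int (n choose k) * central_trinomial (2 * k)) * 4 ^ (p - 1)"
    unfolding sum_distrib_right
  proof (intro sum.cong refl)
    fix k assume "k \<in> {0..p - 1}"
    then have "(4 :: int) ^ (p - 1) = 4 ^ k * 4 ^ (p - 1 - k)"
      by (simp flip: power_add)
    moreover have "(- 4 :: int) ^ k = (- 1) ^ k * 4 ^ k"
      by (simp flip: power_mult_distrib)
    ultimately show "((- 4) ^ k * int (n choose k)) * central_trinomial (2 * k) * 4 ^ (p - 1 - k)
        = (- 1) ^ k * int (n choose k) * central_trinomial (2 * k) * 4 ^ (p - 1)"
      by simp
  qed
  \<comment> \<open>The terms with \<open>k > n\<close> drop out, since there
    \<open>n choose k = 0\<close>.\<close>
  also have "(\<Sum>k = 0..p - 1. (- 1) ^ k * int (n choose k) * central_trinomial (2 * k))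
      = (\<Sum>k\<le>n. (- 1) ^ k * int (n choose k) * central_trinomial (2 * k))"
    by (intro sum.mono_neutral_right) (auto simp: p)
  also have "[\<dots> * 4 ^ (p - 1) = Legendre (- 2) (int p) * 4 ^ (p - 1)] (mod int p)"
  proof (intro cong_mult cong_refl)
    \<comment> \<open>The exponent \<open>(p - 1) div 2\<close> in Euler's criterion is exactly
      \<open>n\<close>.\<close>
    have "[Legendre (- 2) (int p) = (- 2) ^ n] (mod int p)"
      using euler_criterion[OF assms(1) \<open>p > 2\<close>, of "- 2"] by (simp add: p)
    then show "[(\<Sum>k\<le>n. (- 1) ^ k * int (n choose k) * central_trinomial (2 * k))
        = Legendre (- 2) (int p)] (mod int p)"
      using cong_sum_choose_central_trinomial[of n] assms(1) p by (metis cong_sym cong_trans)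
  qed
  finally have "rat_cong p (of_int A / of_int (4 ^ (p - 1))) (of_int (Legendre (- 2) (int p)))"
    using coprime by (intro rat_cong_of_int_divide) auto
  moreover have "(of_int A / of_int (4 ^ (p - 1)) :: rat)
    = (\<Sum>k = 0..p - 1. of_nat ((2 * k) choose k) * of_int (central_trinomial (2 * k)) / 4 ^ k)"
    unfolding A_def of_int_sum sum_divide_distrib
    by (intro sum.cong refl) (use \<open>p > 2\<close> in \<open>simp add: frac_eq_eq flip: power_add\<close>)
  ultimately show ?thesis by simp
qed

end
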